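(* Let $(X,\mathcal{T})$ be an algebraic $E$-test space and let $f,g\in\mathcal{E}(X,\mathcal{T})$. Then the join $\pi(f)\lor\pi(g)$ exists in $\Pi(X)$ if and only if there exist $f_1,f_2,f_3,f_4\in\mathcal{T}$ such that $f,g$ satisfy the J-condition for $(f_1,f_2,f_3,f_4)$. Moreover, if $f,g$ satisfy the J-condition for $(f_1,f_2,f_3,f_4)\in ub(f,g)$, then $$\pi(f)\lor\pi(g)=\pi(h),$$ where $h(x)=\max\bigl(f(x)-f_1(x)+f_2(x),\; g(x)-f_3(x)+f_4(x),\; 0\bigr)$ for every $x\in X$.
   Context: Let $X$ be a nonempty set, $\mathbb{N}_0=\{0,1,2,\dots\}$. Functions $X\to\mathbb{Z}$ are compared, added, subtracted, and have maxima taken pointwise (expressions such as $f-f_1+f_2$ are integer-valued functions on $X$, possibly with negative values); $f\le g$ means $f(x)\le g(x)$ for all $x\in X$; $f_0$ is the zero function. A pair $(X,\mathcal{T})$ with $\mathcal{T}\subseteq\mathbb{N}_0^X$ is an $E$-test space if (1) for every $x\in X$ there is $t\in\mathcal{T}$ with $t(x)\neq 0$, and (2) $s,t\in\mathcal{T}$ and $s\le t$ imply $s=t$. Put $\mathcal{E}(X,\mathcal{T})=\{f\in\mathbb{N}_0^X : f\le t\text{ for some }t\in\mathcal{T}\}$. For $f,g,h\in\mathcal{E}(X,\mathcal{T})$: $f\perp g$ means $f+g\in\mathcal{E}(X,\mathcal{T})$; $f\approx_h g$ means $f+h\in\mathcal{T}$ and $g+h\in\mathcal{T}$; $f\approx g$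 means $f\approx_h g$ for some $h\in\mathcal{E}(X,\mathcal{T})$. The $E$-test space is algebraic if for all $f,g,h\in\mathcal{E}(X,\mathcal{T})$, $f\approx g$ and $h\perp f$ imply $h\perp g$. For an algebraic $E$-test space, $\pi(f)=\{g\in\mathcal{E}(X,\mathcal{T}): g\approx f\}$ for $f\in\mathcal{E}(X,\mathcal{T})$, and $\Pi(X)=\{\pi(f): f\in\mathcal{E}(X,\mathcal{T})\}$, which is an effect algebra (a known result of Gudder) with $0=\pi(f_0)$, $1=\pi(t)$ for any $t\in\mathcal{T}$, and partial operation $\pi(f)\oplus\pi(g)=\pi(f+g)$, defined when $f\perp g$. The partial order on $\Pi(X)$ is: $p\le q$ iff there is $r\in\Pi(X)$ such that $p\oplus r$ is defined and $p\oplus r=q$. Joins are taken in this partial order. For $f,g\in\mathcal{E}(X,\mathcal{T})$ define $$ub(f,g)=\{(f_1,f_2,f_3,f_4)\in\mathcal{T}^4 : f\le f_1,\ g\le f_3,\ f-f_1+f_2\le f_4,\ g-f_3+f_4\le f_2\}.$$ For every $(f_1,f_2,f_3,f_4)\in ub(f,g)$ the function $\max(f-f_1+f_2,\,g-f_3+f_4,\,f_0)$ belongs to $\mathcal{E}(X,\mathcal{T})$. $f,g$ satisfy the J-condition for $(f_1,f_2,f_3,f_4)\in\mathcal{T}^4$ if and only if: (J1) $(f_1,f_2,f_3,f_4)\in ub(f,g)$, i.e. $f\le f_1$, $g\le f_3$, $f-f_1+f_2\le f_4$, $g-f_3+f_4\le f_2$; and (J2) for every $(g_1,g_2,g_3,g_4)\in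 ub(f,g)$ one has $$\pi(\max(f-f_1+f_2,\,g-f_3+f_4,\,f_0))\le\pi(\max(f-g_1+g_2,\,g-g_3+g_4,\,f_0)).$$ *)

theory Defs
  imports "HOL-Algebra.Lattice" "HOL-Library.Function_Algebras"
begin

text \<open>The nonempty set X is the type \<open>'a\<close> (HOL types are nonempty).  On functions \<open>'a \<Rightarrow> nat\<close>,
  both \<open>\<le>\<close> and \<open>+\<close> are pointwise.\<close>

definition etest_space :: "('a \<Rightarrow> nat) set \<Rightarrow> bool" where
  "etest_space T \<longleftrightarrow>
     (\<forall>x. \<exists>t\<in>T. t x \<noteq> 0) \<and> (\<forall>s\<in>T. \<forall>t\<in>T. s \<le> t \<longrightarrow> s = t)"

definition events :: "('a \<Rightarrow> nat) set \<Rightarrow> ('a \<Rightarrow> nat) set" where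
  "events T = {f. \<exists>t\<in>T. f \<le> t}"

definition orth :: "('a \<Rightarrow> nat) set \<Rightarrow> ('a \<Rightarrow> nat) \<Rightarrow> ('a \<Rightarrow> nat) \<Rightarrow> bool" where
  "orth T f g \<longleftrightarrow> f + g \<in> events T"

definition persp_via ::
  "('a \<Rightarrow> nat) set \<Rightarrow> ('a \<Rightarrow> nat) \<Rightarrow> ('a \<Rightarrow> nat) \<Rightarrow> ('a \<Rightarrow> nat) \<Rightarrow> bool" where
  "persp_via T h f g \<longleftrightarrow> f + h \<in> T \<and> g + h \<in> T"

definition persp :: "('a \<Rightarrow> nat) set \<Rightarrow> ('a \<Rightarrow> nat) \<Rightarrow> ('a \<Rightarrow> nat) \<Rightarrow> bool" where
  "persp T f g \<longleftrightarrow> (\<exists>h\<in>events T. persp_via T h f g)"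

definition algebraic_etest_space :: "('a \<Rightarrow> nat) set \<Rightarrow> bool" where
  "algebraic_etest_space T \<longleftrightarrow> etest_space T \<and>
     (\<forall>f\<in>events T. \<forall>g\<in>events T. \<forall>h\<in>events T. persp T f g \<and> orth T h f \<longrightarrow> orth T h g)"

definition pi_class :: "('a \<Rightarrow> nat) set \<Rightarrow> ('a \<Rightarrow> nat) \<Rightarrow> ('a \<Rightarrow> nat) set" where
  "pi_class T f = {g \<in> events T. persp T g f}"

definition Pi_classes :: "('a \<Rightarrow> nat) set \<Rightarrow> ('a \<Rightarrow> nat) set set" where
  "Pi_classes T = pi_class T ` events T"

text \<open>Graph of the partial operation: \<open>oplus T p q r\<close> says that the sum of \<open>p\<close> and \<open>q\<close> is defined
  and equal to \<open>r\<close>.  For algebraic \<open>T\<close> it is single-valued and independent of the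
  representatives, see \<open>oplus_unique\<close> and \<open>oplus_pi_class\<close> below.\<close>

definition oplus ::
  "('a \<Rightarrow> nat) set \<Rightarrow> ('a \<Rightarrow> nat) set \<Rightarrow> ('a \<Rightarrow> nat) set \<Rightarrow> ('a \<Rightarrow> nat) set \<Rightarrow> bool" where
  "oplus T p q r \<longleftrightarrow>
     (\<exists>f\<in>events T. \<exists>g\<in>events T.
        p = pi_class T f \<and> q = pi_class T g \<and> orth T f g \<and> r = pi_class T (f + g))"

definition Pi_le :: "('a \<Rightarrow> nat) set \<Rightarrow> ('a \<Rightarrow> nat) set \<Rightarrow> ('a \<Rightarrow> nat) set \<Rightarrow> bool" where
  "Pi_le T p q \<longleftrightarrow> (\<exists>r\<in>Pi_classes T. oplus T p r q)"

definition Pi_order :: "('a \<Rightarrow> nat) set \<Rightarrow> ('a \<Rightarrow> nat) set gorder" where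
  "Pi_order T = \<lparr>carrier = Pi_classes T, eq = (=), le = Pi_le T\<rparr>"

definition ub ::
  "('a \<Rightarrow> nat) set \<Rightarrow> ('a \<Rightarrow> nat) \<Rightarrow> ('a \<Rightarrow> nat) \<Rightarrow>
     (('a \<Rightarrow> nat) \<times> ('a \<Rightarrow> nat) \<times> ('a \<Rightarrow> nat) \<times> ('a \<Rightarrow> nat)) set" where
  "ub T f g = {(f1, f2, f3, f4). f1 \<in> T \<and> f2 \<in> T \<and> f3 \<in> T \<and> f4 \<in> T \<and>
     f \<le> f1 \<and> g \<le> f3 \<and>
     (\<forall>x. int (f x) - int (f1 x) + int (f2 x) \<le> int (f4 x)) \<and>
     (\<forall>x. int (g x) - int (f3 x) + int (f4 x) \<le> int (f2 x))}"

text \<open>The maximum is spelled out pointwise because \<open>max\<close> at a function type is not the pointwise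
  maximum; \<open>nat\<close> is only applied to nonnegative integers.\<close>

definition ub_max ::
  "('a \<Rightarrow> nat) \<Rightarrow> ('a \<Rightarrow> nat) \<Rightarrow>
     ('a \<Rightarrow> nat) \<Rightarrow> ('a \<Rightarrow> nat) \<Rightarrow> ('a \<Rightarrow> nat) \<Rightarrow> ('a \<Rightarrow> nat) \<Rightarrow> 'a \<Rightarrow> nat" where
  "ub_max f g f1 f2 f3 f4 = (\<lambda>x. nat (Max
     {int (f x) - int (f1 x) + int (f2 x), int (g x) - int (f3 x) + int (f4 x), 0}))"

definition J_condition ::
  "('a \<Rightarrow> nat) set \<Rightarrow> ('a \<Rightarrow> nat) \<Rightarrow> ('a \<Rightarrow> nat) \<Rightarrow>
     ('a \<Rightarrow> nat) \<Rightarrow> ('a \<Rightarrow> nat) \<Rightarrow> ('a \<Rightarrow> nat) \<Rightarrow> ('a \<Rightarrow> nat) \<Rightarrow> bool" where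
  "J_condition T f g f1 f2 f3 f4 \<longleftrightarrow> (f1, f2, f3, f4) \<in> ub T f g \<and>
     (\<forall>(g1, g2, g3, g4) \<in> ub T f g.
        Pi_le T (pi_class T (ub_max f g f1 f2 f3 f4)) (pi_class T (ub_max f g g1 g2 g3 g4)))"

lemma events_compl: "f \<in> events T \<Longrightarrow> \<exists>h\<in>events T. f + h \<in> T"
proof -
  assume "f \<in> events T"
  then obtain t where t: "t \<in> T" "f \<le> t" by (auto simp: events_def)
  have "f + (t - f) = t" using t(2) by (auto simp: le_fun_def fun_eq_iff)
  moreover have "t - f \<in> events T"
    unfolding events_def mem_Collect_eq by (rule bexI[OF _ t(1)]) (simp add: le_fun_def)
  ultimately show ?thesis using t(1) by metis
qed

lemma events_down: "g \<in> events T \<Longrightarrow> f \<le> g \<Longrightarrow> f \<in> events T"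
  by (auto simp: events_def intro: order_trans)

lemma persp_sym: "persp T f g \<Longrightarrow> persp T g f"
  by (auto simp: persp_def persp_via_def)

lemma persp_refl: "f \<in> events T \<Longrightarrow> persp T f f"
  using events_compl by (fastforce simp: persp_def persp_via_def)

lemma events_summand: "f + h \<in> T \<Longrightarrow> f \<in> events T"
proof -
  assume "f + h \<in> T"
  moreover have "f \<le> f + h" by (simp add: le_fun_def)
  ultimately show ?thesis unfolding events_def by blast
qed

lemma persp_events: "persp T f g \<Longrightarrow> f \<in> events T \<and> g \<in> events T"
  unfolding persp_def persp_via_def using events_summand by blast

lemma persp_exchange:
  assumes "algebraic_etest_space T" "persp T f g" "f + h \<in> T"
  shows "g + h \<in> T"
proof -
  have anti: "s = t" if "s \<in> T" "t \<in> T" "s \<le> t" for s t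
    using assms(1) that by (auto simp: algebraic_etest_space_def etest_space_def)
  have alg: "orth T h b"
    if "a \<in> events T" "b \<in> events T" "h \<in> events T" "persp T a b" "orth T h a" for a b h
    using assms(1) that unfolding algebraic_etest_space_def by blast
  note fg = persp_events[OF assms(2)]
  have fh: "f + h \<in> events T" using assms(3) by (auto simp: events_def)
  have h: "h \<in> events T" by (rule events_down[OF fh]) (auto simp: le_fun_def)
  have "orth T h g"
    using alg[of f g h] fg h assms(2) fh by (simp add: orth_def add.commute)
  then obtain s where s: "s \<in> T" "h + g \<le> s" by (auto simp: orth_def events_def)
  define m where "m = s - (h + g)"
  have sm: "g + (h + m) = s"
  proof
    fix x
    have "h x + g x \<le> s x" using s(2) by (simp add: le_fun_def)
    then show "(g + (h + m)) x = s x" by (simp add: m_def)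
  qed
  have se: "s \<in> events T" using s(1) by (auto simp: events_def)
  have "h + m \<in> events T" by (rule events_down[OF se]) (auto simp: sm[symmetric] le_fun_def)
  then have "orth T (h + m) f"
    using alg[of g f "h + m"] fg persp_sym[OF assms(2)] se sm by (simp add: orth_def add.commute)
  then obtain u where u: "u \<in> T" "h + m + f \<le> u" by (auto simp: orth_def events_def)
  have "f + h \<le> h + m + f" by (auto simp: le_fun_def)
  then have "f + h = u" using anti[OF assms(3) u(1)] u(2) by (metis order_trans)
  then have "h x + m x + f x \<le> f x + h x" for x using u(2) by (auto simp: le_fun_def)
  then have "m = 0" by (simp add: fun_eq_iff add_ac)
  then show ?thesis using sm s(1) by simp
qed

lemma pi_class_eq_iff:
  assumes "algebraic_etest_space T" "f \<in> events T" "g \<in> events T"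
  shows "pi_class T f = pi_class T g \<longleftrightarrow> persp T f g"
proof
  assume "pi_class T f = pi_class T g"
  then show "persp T f g" using persp_refl[OF assms(2)] assms(2) by (auto simp: pi_class_def)
next
  have tr: "persp T a c" if "persp T a b" "persp T b c" for a b c
    using that persp_exchange[OF assms(1) that(2)] by (auto simp: persp_def persp_via_def)
  assume "persp T f g"
  then show "pi_class T f = pi_class T g"
    unfolding pi_class_def using tr[of _ f g] tr[of _ g f] persp_sym[of T f g] by blast
qed

lemma oplus_pi_class:
  assumes "algebraic_etest_space T" "f \<in> events T" "g \<in> events T"
  shows "oplus T (pi_class T f) (pi_class T g) r \<longleftrightarrow> orth T f g \<and> r = pi_class T (f + g)"
proof
  assume "oplus T (pi_class T f) (pi_class T g) r"
  then obtain f' g' where *: "f' \<in> events T" "g' \<in> events T" "pi_class T f = pi_class T f'"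
    "pi_class T g = pi_class T g'" "orth T f' g'" "r = pi_class T (f' + g')"
    by (auto simp: oplus_def)
  have p: "persp T f' f" "persp T g' g"
    using * assms pi_class_eq_iff persp_sym by metis+
  obtain k where k: "k \<in> events T" "f' + g' + k \<in> T"
    using events_compl *(5) by (auto simp: orth_def)
  have "f + (g' + k) \<in> T" using persp_exchange[OF assms(1) p(1), of "g' + k"] k(2) by (simp add: add.assoc)
  then have "g + (f + k) \<in> T" using persp_exchange[OF assms(1) p(2), of "f + k"] by (simp add: add_ac)
  then have fgk: "f + g + k \<in> T" by (simp add: add_ac)
  then have o: "orth T f g"
    unfolding orth_def by (rule events_summand)
  have "persp T (f + g) (f' + g')" using fgk k by (auto simp: persp_def persp_via_def)
  then show "orth T f g \<and> r = pi_class T (f + g)"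
    using o *(5,6) pi_class_eq_iff[OF assms(1), of "f + g" "f' + g'"] by (simp add: orth_def)
qed (use assms in \<open>auto simp: oplus_def\<close>)

lemma oplus_unique:
  assumes "algebraic_etest_space T" "oplus T p q r" "oplus T p q r'"
  shows "r = r'"
  using assms oplus_pi_class[OF assms(1)] unfolding oplus_def[of T p q r] by auto

end

theory Submission
  imports Defs
begin

text \<open>Everything reduces to a complement criterion for the order: if \<open>k + c\<close> is a test, then
  \<open>\<pi>(f) \<le> \<pi>(k)\<close> holds exactly when \<open>f + c\<close> is still an event (lemma \<open>Pi_le_iff\<close>).  So a class is
  a common upper bound of \<open>\<pi>(f)\<close> and \<open>\<pi>(g)\<close> precisely when the complement of one of its
  representatives fits under a test together with \<open>f\<close>, and also together with \<open>g\<close>.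

  The quadruples in \<open>ub T f g\<close> encode such upper bounds.  The event \<open>h\<close> that a quadruple produces
  lies below both \<open>f2\<close> and \<open>f4\<close>, and it is chosen so large that \<open>f2 - h \<le> f1 - f\<close> and
  \<open>f4 - h \<le> f3 - g\<close>; by the criterion \<open>\<pi>(h)\<close> is an upper bound (lemma \<open>ub_max_upper\<close>).
  Conversely, every upper bound dominates one of this kind (lemma \<open>ub_max_coinitial\<close>).
  The classes \<open>\<pi>(h)\<close> are therefore coinitial among the upper bounds, and the join exists if and
  only if they have a least member, which is the J-condition; that least member is then the join.\<close>

section \<open>The order on classes of events\<close>

text \<open>Any complement \<open>c\<close> of \<open>k\<close> may be used, since perspective events have the same complements.\<close>

lemma Pi_le_iff:
  assumes alg: "algebraic_etest_space T" and f: "f \<in> events T" and kc: "k + c \<in> T"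
  shows "Pi_le T (pi_class T f) (pi_class T k) \<longleftrightarrow> f + c \<in> events T"
proof -
  have k: "k \<in> events T" using kc by (rule events_summand)
  show ?thesis
  proof
    assume "Pi_le T (pi_class T f) (pi_class T k)"
    then obtain s where s: "s \<in> events T" "oplus T (pi_class T f) (pi_class T s) (pi_class T k)"
      by (auto simp: Pi_le_def Pi_classes_def)
    then have "f + s \<in> events T" "pi_class T k = pi_class T (f + s)"
      using oplus_pi_class[OF alg f s(1)] by (auto simp: orth_def)
    then have "persp T k (f + s)" using pi_class_eq_iff[OF alg k] by blast
    then have "(f + s) + c \<in> T" by (rule persp_exchange[OF alg _ kc])
    then have "(f + c) + s \<in> T" by (simp add: add_ac)
    then show "f + c \<in> events T" by (rule events_summand)
  next
    assume "f + c \<in> events T"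
    then obtain s where "s \<in> events T" "(f + c) + s \<in> T" using events_compl by blast
    then have s: "s \<in> events T" and t: "(f + s) + c \<in> T" by (simp_all add: add_ac)
    have fs: "f + s \<in> events T" using t by (rule events_summand)
    have "c + k \<in> T" using kc by (simp add: add.commute)
    then have "c \<in> events T" by (rule events_summand)
    then have "persp T (f + s) k" using t kc by (auto simp: persp_def persp_via_def)
    then have "pi_class T (f + s) = pi_class T k" using pi_class_eq_iff[OF alg fs k] by blast
    then have "oplus T (pi_class T f) (pi_class T s) (pi_class T k)"
      using oplus_pi_class[OF alg f s] fs by (simp add: orth_def)
    then show "Pi_le T (pi_class T f) (pi_class T k)"
      using s by (auto simp: Pi_le_def Pi_classes_def)
  qed
qed

lemma Pi_le_mono:
  assumes alg: "algebraic_etest_space T" and k: "k \<in> events T" and "h \<le> k"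
  shows "Pi_le T (pi_class T h) (pi_class T k)"
proof -
  obtain c where kc: "k + c \<in> T" using events_compl[OF k] by blast
  have "h + c \<in> events T"
    using kc \<open>h \<le> k\<close> by (auto simp: events_def le_fun_def intro!: bexI[of _ "k + c"])
  then show ?thesis using Pi_le_iff[OF alg events_down[OF k \<open>h \<le> k\<close>] kc] by blast
qed

lemma Pi_le_trans:
  assumes alg: "algebraic_etest_space T"
    and ev: "f \<in> events T" "g \<in> events T" "h \<in> events T"
    and fg: "Pi_le T (pi_class T f) (pi_class T g)"
    and gh: "Pi_le T (pi_class T g) (pi_class T h)"
  shows "Pi_le T (pi_class T f) (pi_class T h)"
proof -
  obtain c where hc: "h + c \<in> T" using events_compl[OF ev(3)] by blast
  have "g + c \<in> events T" using gh Pi_le_iff[OF alg ev(2) hc] by blast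
  then obtain s where "(g + c) + s \<in> T" using events_compl by blast
  then have "g + (c + s) \<in> T" by (simp add: add.assoc)
  then have "f + (c + s) \<in> events T" using fg Pi_le_iff[OF alg ev(1)] by blast
  then have "f + c \<in> events T" by (rule events_down) (simp add: le_fun_def)
  then show ?thesis using Pi_le_iff[OF alg ev(1) hc] by blast
qed

text \<open>If \<open>f + c + s\<close> and \<open>g + c\<close> are tests and \<open>\<pi>(g) \<le> \<pi>(f)\<close>, then \<open>g + c + s\<close> is an event that
  contains the test \<open>g + c\<close>.  Tests are incomparable, so \<open>s = 0\<close> and \<open>c\<close> is a common complement.\<close>

lemma Pi_le_antisym:
  assumes alg: "algebraic_etest_space T"
    and ev: "f \<in> events T" "g \<in> events T"
    and fg: "Pi_le T (pi_class T f) (pi_class T g)"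
    and gf: "Pi_le T (pi_class T g) (pi_class T f)"
  shows "pi_class T f = pi_class T g"
proof -
  obtain c where c: "c \<in> events T" and gc: "g + c \<in> T" using events_compl[OF ev(2)] by blast
  have "f + c \<in> events T" using fg Pi_le_iff[OF alg ev(1) gc] by blast
  then obtain s where "(f + c) + s \<in> T" using events_compl by blast
  then have fcs: "f + (c + s) \<in> T" by (simp add: add.assoc)
  then have "g + (c + s) \<in> events T" using gf Pi_le_iff[OF alg ev(2)] by blast
  then obtain t where t: "t \<in> T" "g + (c + s) \<le> t" by (auto simp: events_def)
  have "g + c \<le> g + (c + s)" by (simp add: le_fun_def)
  then have "g + c \<le> t" using t(2) by (rule order_trans)
  then have "g + c = t"
    using alg gc t(1) unfolding algebraic_etest_space_def etest_space_def by blast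
  then have "g x + (c x + s x) \<le> g x + c x" for x using t(2) by (auto simp: le_fun_def)
  then have "s = 0" by (simp add: fun_eq_iff)
  then have "persp T f g" using fcs gc c by (auto simp: persp_def persp_via_def)
  then show ?thesis using pi_class_eq_iff[OF alg ev] by blast
qed

lemma partial_order_Pi_order:
  assumes alg: "algebraic_etest_space T"
  shows "partial_order (Pi_order T)"
proof
  show "(.=\<^bsub>Pi_order T\<^esub>) = (=)" by (simp add: Pi_order_def)
qed (auto 0 3 simp: Pi_order_def Pi_classes_def
       intro: Pi_le_mono[OF alg] Pi_le_trans[OF alg] dest: Pi_le_antisym[OF alg])

section \<open>Upper bounds from quadruples of tests\<close>

lemma int_ub_max:
  "int (ub_max f g f1 f2 f3 f4 x) =
     max (int (f x) - int (f1 x) + int (f2 x)) (max (int (g x) - int (f3 x) + int (f4 x)) 0)"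
  by (simp add: ub_max_def max_def)

lemma ub_max_le:
  assumes "(f1, f2, f3, f4) \<in> ub T f g"
  shows "ub_max f g f1 f2 f3 f4 \<le> f2" and "ub_max f g f1 f2 f3 f4 \<le> f4"
proof -
  have "int (ub_max f g f1 f2 f3 f4 x) \<le> int (f2 x) \<and> int (ub_max f g f1 f2 f3 f4 x) \<le> int (f4 x)" for x
  proof -
    have "f x \<le> f1 x" "g x \<le> f3 x"
      "int (f x) - int (f1 x) + int (f2 x) \<le> int (f4 x)"
      "int (g x) - int (f3 x) + int (f4 x) \<le> int (f2 x)"
      using assms by (auto simp: ub_def le_fun_def)
    then show ?thesis unfolding int_ub_max by linarith
  qed
  then show "ub_max f g f1 f2 f3 f4 \<le> f2" and "ub_max f g f1 f2 f3 f4 \<le> f4"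
    by (auto simp: le_fun_def)
qed

lemma ub_max_events:
  assumes "(f1, f2, f3, f4) \<in> ub T f g"
  shows "ub_max f g f1 f2 f3 f4 \<in> events T"
  using ub_max_le(1)[OF assms] assms by (auto simp: events_def ub_def)

text \<open>The complement \<open>b - h\<close> of \<open>h\<close> fits into \<open>a - f\<close>, so the criterion applies.  For a quadruple
  in \<open>ub T f g\<close> this is used once with the tests \<open>f1\<close>, \<open>f2\<close> and once with \<open>f3\<close>, \<open>f4\<close>.\<close>

lemma Pi_le_via_tests:
  assumes alg: "algebraic_etest_space T" and "a \<in> T" "b \<in> T"
    and fa: "f \<le> a" and hb: "h \<le> b" and fits: "\<And>x. f x + b x \<le> a x + h x"
  shows "Pi_le T (pi_class T f) (pi_class T h)"
proof -
  have f: "f \<in> events T" using fa \<open>a \<in> T\<close> by (auto simp: events_def)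
  have "h + (b - h) = b" using hb by (auto simp: le_fun_def fun_eq_iff)
  then have compl: "h + (b - h) \<in> T" using \<open>b \<in> T\<close> by simp
  have "f x + (b x - h x) \<le> a x" for x
    using fits[of x] le_funD[OF hb, of x] by linarith
  then have "f + (b - h) \<le> a" by (simp add: le_fun_def)
  then have "f + (b - h) \<in> events T" using \<open>a \<in> T\<close> by (auto simp: events_def)
  then show ?thesis using Pi_le_iff[OF alg f compl] by blast
qed

lemma ub_max_upper:
  assumes alg: "algebraic_etest_space T" and q: "(f1, f2, f3, f4) \<in> ub T f g"
  shows "Pi_le T (pi_class T f) (pi_class T (ub_max f g f1 f2 f3 f4))"
    and "Pi_le T (pi_class T g) (pi_class T (ub_max f g f1 f2 f3 f4))"
proof -
  have t: "f1 \<in> T" "f2 \<in> T" "f3 \<in> T" "f4 \<in> T" "f \<le> f1" "g \<le> f3"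
    using q by (auto simp: ub_def)
  have "f x + f2 x \<le> f1 x + ub_max f g f1 f2 f3 f4 x" for x
    using int_ub_max[of f g f1 f2 f3 f4 x] by linarith
  then show "Pi_le T (pi_class T f) (pi_class T (ub_max f g f1 f2 f3 f4))"
    using Pi_le_via_tests[OF alg t(1,2,5) ub_max_le(1)[OF q]] by blast
  have "g x + f4 x \<le> f3 x + ub_max f g f1 f2 f3 f4 x" for x
    using int_ub_max[of f g f1 f2 f3 f4 x] by linarith
  then show "Pi_le T (pi_class T g) (pi_class T (ub_max f g f1 f2 f3 f4))"
    using Pi_le_via_tests[OF alg t(3,4,6) ub_max_le(2)[OF q]] by blast
qed

text \<open>With \<open>c\<close> a complement of \<open>k\<close>, complete \<open>f + c\<close> and \<open>g + c\<close> to tests \<open>f + c + s\<close> and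
  \<open>g + c + r\<close>, and use \<open>k + c\<close> for both \<open>f2\<close> and \<open>f4\<close>.  The two differences are then \<open>k - s\<close> and
  \<open>k - r\<close>, so the event produced is pointwise below \<open>k\<close>.\<close>

lemma ub_max_coinitial:
  assumes alg: "algebraic_etest_space T"
    and ev: "f \<in> events T" "g \<in> events T" "k \<in> events T"
    and fk: "Pi_le T (pi_class T f) (pi_class T k)"
    and gk: "Pi_le T (pi_class T g) (pi_class T k)"
  obtains f1 f2 f3 f4 where "(f1, f2, f3, f4) \<in> ub T f g"
    and "Pi_le T (pi_class T (ub_max f g f1 f2 f3 f4)) (pi_class T k)"
proof -
  obtain c where kc: "k + c \<in> T" using events_compl[OF ev(3)] by blast
  have "f + c \<in> events T" "g + c \<in> events T"
    using fk gk Pi_le_iff[OF alg _ kc] ev by blast+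
  then obtain s r where s: "f + c + s \<in> T" and r: "g + c + r \<in> T"
    using events_compl by meson
  have "(f + c + s, k + c, g + c + r, k + c) \<in> ub T f g"
    using s r kc by (auto simp: ub_def le_fun_def)
  moreover have "int (ub_max f g (f + c + s) (k + c) (g + c + r) (k + c) x) \<le> int (k x)" for x
    unfolding int_ub_max by simp
  then have "ub_max f g (f + c + s) (k + c) (g + c + r) (k + c) \<le> k"
    by (simp add: le_fun_def)
  then have "Pi_le T (pi_class T (ub_max f g (f + c + s) (k + c) (g + c + r) (k + c))) (pi_class T k)"
    by (rule Pi_le_mono[OF alg ev(3)])
  ultimately show thesis by (rule that)
qed

section \<open>Joins and the J-condition\<close>

lemma is_lub_pi_class_iff:
  assumes "f \<in> events T" "g \<in> events T" "h \<in> events T"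
  shows "is_lub (Pi_order T) (pi_class T h) {pi_class T f, pi_class T g} \<longleftrightarrow>
    Pi_le T (pi_class T f) (pi_class T h) \<and> Pi_le T (pi_class T g) (pi_class T h) \<and>
    (\<forall>k\<in>events T. Pi_le T (pi_class T f) (pi_class T k) \<and> Pi_le T (pi_class T g) (pi_class T k)
       \<longrightarrow> Pi_le T (pi_class T h) (pi_class T k))"
  using assms by (auto simp: least_def Upper_def Pi_order_def Pi_classes_def)

lemma J_condition_imp_is_lub:
  assumes alg: "algebraic_etest_space T" and f: "f \<in> events T" and g: "g \<in> events T"
    and J: "J_condition T f g f1 f2 f3 f4"
  shows "is_lub (Pi_order T) (pi_class T (ub_max f g f1 f2 f3 f4)) {pi_class T f, pi_class T g}"
proof -
  let ?h = "ub_max f g f1 f2 f3 f4"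
  have q: "(f1, f2, f3, f4) \<in> ub T f g" using J by (simp add: J_condition_def)
  have h: "?h \<in> events T" using q by (rule ub_max_events)
  have "Pi_le T (pi_class T ?h) (pi_class T k)"
    if k: "k \<in> events T" "Pi_le T (pi_class T f) (pi_class T k)"
      "Pi_le T (pi_class T g) (pi_class T k)" for k
  proof -
    obtain g1 g2 g3 g4 where q': "(g1, g2, g3, g4) \<in> ub T f g"
      and le: "Pi_le T (pi_class T (ub_max f g g1 g2 g3 g4)) (pi_class T k)"
      using ub_max_coinitial[OF alg f g k] by blast
    have "Pi_le T (pi_class T ?h) (pi_class T (ub_max f g g1 g2 g3 g4))"
      using J q' by (auto simp: J_condition_def)
    then show ?thesis using Pi_le_trans[OF alg h ub_max_events[OF q'] k(1)] le by blast
  qed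
  then show ?thesis using is_lub_pi_class_iff[OF f g h] ub_max_upper[OF alg q] by blast
qed

lemma is_lub_imp_J_condition:
  assumes alg: "algebraic_etest_space T" and f: "f \<in> events T" and g: "g \<in> events T"
    and lub: "is_lub (Pi_order T) r {pi_class T f, pi_class T g}"
  obtains f1 f2 f3 f4 where "J_condition T f g f1 f2 f3 f4"
proof -
  obtain k where k: "k \<in> events T" and "r = pi_class T k"
    using lub by (auto simp: least_def Upper_def Pi_order_def Pi_classes_def)
  then have upper: "Pi_le T (pi_class T f) (pi_class T k)" "Pi_le T (pi_class T g) (pi_class T k)"
    and least: "\<And>h. h \<in> events T \<Longrightarrow> Pi_le T (pi_class T f) (pi_class T h) \<Longrightarrow>
      Pi_le T (pi_class T g) (pi_class T h) \<Longrightarrow> Pi_le T (pi_class T k) (pi_class T h)"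
    using lub is_lub_pi_class_iff[OF f g k] by auto
  obtain f1 f2 f3 f4 where q: "(f1, f2, f3, f4) \<in> ub T f g"
    and le: "Pi_le T (pi_class T (ub_max f g f1 f2 f3 f4)) (pi_class T k)"
    using ub_max_coinitial[OF alg f g k upper] by blast
  have "Pi_le T (pi_class T (ub_max f g f1 f2 f3 f4)) (pi_class T (ub_max f g g1 g2 g3 g4))"
    if q': "(g1, g2, g3, g4) \<in> ub T f g" for g1 g2 g3 g4
    using Pi_le_trans[OF alg ub_max_events[OF q] k ub_max_events[OF q'] le]
      least[OF ub_max_events[OF q'] ub_max_upper[OF alg q']] by blast
  then have "J_condition T f g f1 f2 f3 f4" using q by (auto simp: J_condition_def)
  then show thesis by (rule that)
qed

text \<open>The join is defined by choosing some least upper bound, so its value is determined only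
  because antisymmetry makes least upper bounds unique.\<close>

lemma is_lub_imp_join_eq:
  assumes "algebraic_etest_space T"
    and lub: "is_lub (Pi_order T) r {p, q}"
  shows "p \<squnion>\<^bsub>Pi_order T\<^esub> q = r"
proof -
  interpret partial_order "Pi_order T" using assms(1) by (rule partial_order_Pi_order)
  show ?thesis unfolding join_def sup_def
    using lub by (rule some_equality) (rule least_unique[OF _ lub])
qed

theorem theorem2p7:
  fixes T :: "('a \<Rightarrow> nat) set" and f g :: "'a \<Rightarrow> nat"
  assumes "algebraic_etest_space T"
    and "f \<in> events T" and "g \<in> events T"
  shows "((\<exists>r. is_lub (Pi_order T) r {pi_class T f, pi_class T g}) \<longleftrightarrow>
          (\<exists>f1\<in>T. \<exists>f2\<in>T. \<exists>f3\<in>T. \<exists>f4\<in>T. J_condition T f g f1 f2 f3 f4)) \<and>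
         (\<forall>f1 f2 f3 f4. J_condition T f g f1 f2 f3 f4 \<longrightarrow>
            is_lub (Pi_order T) (pi_class T (ub_max f g f1 f2 f3 f4)) {pi_class T f, pi_class T g} \<and>
            pi_class T f \<squnion>\<^bsub>Pi_order T\<^esub> pi_class T g = pi_class T (ub_max f g f1 f2 f3 f4))"
proof (intro conjI allI impI)
  have J_tests: "f1 \<in> T \<and> f2 \<in> T \<and> f3 \<in> T \<and> f4 \<in> T"
    if "J_condition T f g f1 f2 f3 f4" for f1 f2 f3 f4
    using that by (auto simp: J_condition_def ub_def)
  show "(\<exists>r. is_lub (Pi_order T) r {pi_class T f, pi_class T g}) \<longleftrightarrow>
          (\<exists>f1\<in>T. \<exists>f2\<in>T. \<exists>f3\<in>T. \<exists>f4\<in>T. J_condition T f g f1 f2 f3 f4)"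
  proof
    assume "\<exists>r. is_lub (Pi_order T) r {pi_class T f, pi_class T g}"
    then obtain f1 f2 f3 f4 where "J_condition T f g f1 f2 f3 f4"
      using is_lub_imp_J_condition[OF assms] by metis
    then show "\<exists>f1\<in>T. \<exists>f2\<in>T. \<exists>f3\<in>T. \<exists>f4\<in>T. J_condition T f g f1 f2 f3 f4"
      using J_tests by blast
  next
    assume "\<exists>f1\<in>T. \<exists>f2\<in>T. \<exists>f3\<in>T. \<exists>f4\<in>T. J_condition T f g f1 f2 f3 f4"
    then show "\<exists>r. is_lub (Pi_order T) r {pi_class T f, pi_class T g}"
      using J_condition_imp_is_lub[OF assms] by blast
  qed
next
  fix f1 f2 f3 f4
  assume "J_condition T f g f1 f2 f3 f4"
  then show lub: "is_lub (Pi_order T) (pi_class T (ub_max f g f1 f2 f3 f4))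
      {pi_class T f, pi_class T g}"
    by (rule J_condition_imp_is_lub[OF assms])
  then show "pi_class T f \<squnion>\<^bsub>Pi_order T\<^esub> pi_class T g = pi_class T (ub_max f g f1 f2 f3 f4)"
    by (rule is_lub_imp_join_eq[OF assms(1)])
qed

end
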